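(* For every fixed integer $k\geq 3$, $r(B^{(k)},K^{(k)}_n) > 2^{\Omega(n)}$; that is, there is a constant $c=c(k)>0$ such that $r(B^{(k)},K^{(k)}_n) > 2^{cn}$ for all sufficiently large $n$.
   Context: A $k$-half-graph $B^{(k)}$ is the $k$-uniform hypergraph on $2k-2$ vertices with vertex set $S\cup T$, $S\cap T=\emptyset$, $|S|=|T|=k-1$, whose edges are all $k$-subsets of $S\cup T$ containing $S$, together with one $k$-subset containing $T$. $K^{(k)}_n$ is the complete $k$-uniform hypergraph on $n$ vertices. $r(B^{(k)},K^{(k)}_n)$ is the minimum $N$ such that every red-blue coloring of the $k$-subsets of an $N$-element set contains a red copy of $B^{(k)}$ or a blue copy of $K^{(k)}_n$. *)

theory Defs
  imports Complex_Main "HOL-Library.Ramsey"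
begin

type_synonym 'a hypergraph = "'a set \<times> 'a set set"

abbreviation verts :: "'a hypergraph \<Rightarrow> 'a set" where "verts \<equiv> fst"
abbreviation edges :: "'a hypergraph \<Rightarrow> 'a set set" where "edges \<equiv> snd"

text \<open>
  The half-graph is determined up to isomorphism only (the choice of the edge f through T is
  free), so it is given as a predicate rather than as a single hypergraph.
\<close>

definition is_half_graph :: "nat \<Rightarrow> 'a hypergraph \<Rightarrow> bool" where
  "is_half_graph k B \<longleftrightarrow>
     (\<exists>S T f. finite S \<and> finite T \<and> S \<inter> T = {} \<and> card S = k - 1 \<and> card T = k - 1 \<and>
        f \<in> nsets (S \<union> T) k \<and> T \<subseteq> f \<and>
        verts B = S \<union> T \<and>
        edges B = insert f {e \<in> nsets (S \<union> T) k. S \<subseteq> e})"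

definition complete_hypergraph :: "nat \<Rightarrow> nat \<Rightarrow> nat hypergraph" where
  "complete_hypergraph k n = ({..<n}, nsets {..<n} k)"

text \<open>Copies are subhypergraphs, not necessarily induced.\<close>

definition contains_copy :: "'b hypergraph \<Rightarrow> 'a hypergraph \<Rightarrow> bool" where
  "contains_copy H G \<longleftrightarrow>
     (\<exists>\<phi>. inj_on \<phi> (verts G) \<and> \<phi> ` verts G \<subseteq> verts H \<and> (\<forall>e \<in> edges G. \<phi> ` e \<in> edges H))"

text \<open>A colouring is encoded by its set R of red k-sets; the remaining k-sets are blue.\<close>

definition ramsey_arrow :: "nat \<Rightarrow> nat \<Rightarrow> 'a hypergraph \<Rightarrow> 'b hypergraph \<Rightarrow> bool" where
  "ramsey_arrow k N G H \<longleftrightarrow>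
     (\<forall>R \<subseteq> nsets {..<N} k.
        contains_copy ({..<N}, R) G \<or> contains_copy ({..<N}, nsets {..<N} k - R) H)"

definition ramsey_number :: "nat \<Rightarrow> 'a hypergraph \<Rightarrow> 'b hypergraph \<Rightarrow> nat" where
  "ramsey_number k G H = (LEAST N. ramsey_arrow k N G H)"

text \<open>
  By Ramsey's theorem the minimum is taken over a nonempty set, and half-graphs exist on every
  infinite type.
\<close>

lemma contains_copy_clique:
  assumes G: "finite (verts G)" "edges G \<subseteq> nsets (verts G) k"
    and A: "finite A" "card A = card (verts G)" "A \<subseteq> V" "nsets A k \<subseteq> E"
  shows "contains_copy (V, E) G"
proof -
  obtain \<phi> where \<phi>: "bij_betw \<phi> (verts G) A"
    using finite_same_card_bij[of "verts G" A] G(1) A(1,2) by metis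
  then have inj: "inj_on \<phi> (verts G)" and img: "\<phi> ` verts G = A"
    by (auto simp: bij_betw_def)
  have "\<phi> ` e \<in> E" if "e \<in> edges G" for e
  proof -
    have e: "e \<subseteq> verts G" "finite e" "card e = k"
      using that G(2) by (auto simp: nsets_def)
    have "card (\<phi> ` e) = k"
      using e inj by (metis card_image inj_on_subset)
    then have "\<phi> ` e \<in> nsets A k"
      using e img by (auto simp: nsets_def)
    then show ?thesis using A(4) by blast
  qed
  then show ?thesis
    unfolding contains_copy_def using inj img A(3) by auto
qed

lemma ramsey_arrow_exists:
  assumes G: "finite (verts G)" "edges G \<subseteq> nsets (verts G) k"
    and H: "finite (verts H)" "edges H \<subseteq> nsets (verts H) k"
  shows "\<exists>N. ramsey_arrow k N G H"
proof -
  obtain N :: nat where N: "partn_lst {..<N} [card (verts G), card (verts H)] k"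
    using ramsey2_full by blast
  have "contains_copy ({..<N}, R) G \<or> contains_copy ({..<N}, nsets {..<N} k - R) H"
    if R: "R \<subseteq> nsets {..<N} k" for R
  proof -
    define f :: "nat set \<Rightarrow> nat" where "f = (\<lambda>e. if e \<in> R then 0 else 1)"
    have "f \<in> nsets {..<N} k \<rightarrow> {..<length [card (verts G), card (verts H)]}"
      by (auto simp: f_def)
    from N[unfolded partn_lst_def, rule_format, OF this] obtain i A where
      i: "i < 2" and A: "A \<in> nsets {..<N} ([card (verts G), card (verts H)] ! i)"
      and mono: "f ` nsets A k \<subseteq> {i}"
      by (auto simp: monochromatic_def numeral_2_eq_2)
    have sub: "nsets A k \<subseteq> nsets {..<N} k"
      using A by (auto simp: nsets_def)
    consider "i = 0" | "i = 1" using i by linarith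
    then show ?thesis
    proof cases
      case 1
      have "nsets A k \<subseteq> R"
        using mono 1 by (auto simp: f_def image_subset_iff split: if_splits)
      then show ?thesis
        using contains_copy_clique[OF G, of A "{..<N}" R] A 1 by (auto simp: nsets_def)
    next
      case 2
      have "nsets A k \<subseteq> nsets {..<N} k - R"
        using mono 2 sub by (force simp: f_def image_subset_iff split: if_splits)
      then show ?thesis
        using contains_copy_clique[OF H, of A "{..<N}" "nsets {..<N} k - R"] A 2
        by (auto simp: nsets_def)
    qed
  qed
  then show ?thesis unfolding ramsey_arrow_def by blast
qed

lemma ramsey_arrow_half_graph_exists:
  assumes "is_half_graph k B"
  shows "\<exists>N. ramsey_arrow k N B (complete_hypergraph k n)"
proof (rule ramsey_arrow_exists)
  show "finite (verts B)" "edges B \<subseteq> nsets (verts B) k"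
    using assms by (auto simp: is_half_graph_def)
qed (auto simp: complete_hypergraph_def)

lemma half_graph_exists:
  assumes "k \<ge> 2" "infinite (UNIV :: 'a set)"
  shows "\<exists>B :: 'a hypergraph. is_half_graph k B"
proof -
  obtain S :: "'a set" where S: "finite S" "card S = k - 1"
    using infinite_arbitrarily_large[OF assms(2)] by blast
  have "infinite (- S)" using S(1) assms(2) by (simp add: Compl_eq_Diff_UNIV)
  then obtain T where T: "finite T" "card T = k - 1" "T \<subseteq> - S"
    using infinite_arbitrarily_large by metis
  obtain s where s: "s \<in> S" using S assms(1) by fastforce
  have "insert s T \<in> nsets (S \<union> T) k"
    using S T s assms(1) by (auto simp: nsets_def card_insert_if)
  then have "is_half_graph k (S \<union> T, insert (insert s T) {e \<in> nsets (S \<union> T) k. S \<subseteq> e})"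
    unfolding is_half_graph_def
    using S T by (intro exI[of _ S] exI[of _ T] exI[of _ "insert s T"]) auto
  then show ?thesis by blast
qed

end

theory Submission
  imports Defs "HOL-Library.Disjoint_Sets"
begin

text \<open>
  Colour the pairs of vertices at random by the pairs of positions below k, and make a k-set red
  if each of its pairs carries the positions of its two vertices in the increasing order of the set.
  If S together with t is red for all t in T, then the colours inside S force all t into the same
  position, so for s in S the pairs consisting of t and s all have one colour and T together with
  s is blue. An n-set contains of the order of n^2 many k-sets that pairwise share at most one
  vertex. They are red independently of each other with constant probability, so that no
  k-subset of the n-set is red with probability at most exp (- C n^2) for some C > 0. This beats
  the number of n-sets if the number of vertices is at most 2 powr (c n) for a small c > 0.
\<close>

section \<open>Position colourings and the absence of red half-graphs\<close>

text \<open>On a \<open>k\<close>-set the only strictly increasing \<open>g\<close> into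
  \<open>{..<k}\<close> is the rank map, so quantifying over \<open>g\<close> encodes positions
  without computing ranks.\<close>

definition position_coloured :: "nat \<Rightarrow> ('a::linorder set \<Rightarrow> nat set) \<Rightarrow> 'a set \<Rightarrow> bool" where
  "position_coloured k \<chi> e \<longleftrightarrow>
     (\<exists>g. strict_mono_on e g \<and> g ` e \<subseteq> {..<k} \<and> (\<forall>p \<in> nsets e 2. \<chi> p = g ` p))"

lemma position_colouredE:
  assumes "position_coloured k \<chi> e"
  obtains g where "strict_mono_on e g" "g ` e \<subseteq> {..<k}" "\<And>p. p \<in> nsets e 2 \<Longrightarrow> \<chi> p = g ` p"
  using assms unfolding position_coloured_def by (elim exE conjE) (rule that, simp_all)

text \<open>Each map sends the smaller point to the smaller element of the common image.\<close>

lemma strict_mono_on_eq_if_pair_images_eq: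
  fixes g h :: "'a::linorder \<Rightarrow> 'b::linorder"
  assumes "strict_mono_on A g" "strict_mono_on A h" "x \<in> A" "y \<in> A" "x \<noteq> y"
    and "g ` {x, y} = h ` {x, y}"
  shows "g x = h x"
proof (cases "x < y")
  case True
  then have "g x < g y" "h x < h y"
    using assms by (auto simp: strict_mono_on_def)
  then show ?thesis using assms(6) by (auto simp: doubleton_eq_iff)
next
  case False
  then have "g y < g x" "h y < h x"
    using assms by (auto simp: strict_mono_on_def)
  then show ?thesis using assms(6) by (auto simp: doubleton_eq_iff)
qed

text \<open>
  The colours inside S determine the position of each vertex of S, hence the position left for
  the additional vertex.
\<close>

lemma position_coloured_extensions_agree:
  fixes \<chi> :: "'a::linorder set \<Rightarrow> nat set"
  assumes S: "finite S" "card S = k - 1" "k \<ge> 3"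
    and t: "t \<notin> S" "position_coloured k \<chi> (insert t S)"
    and u: "u \<notin> S" "position_coloured k \<chi> (insert u S)"
    and s: "s \<in> S"
  shows "\<chi> {t, s} = \<chi> {u, s}"
proof -
  obtain g where g: "strict_mono_on (insert t S) g" "g ` insert t S \<subseteq> {..<k}"
      "\<And>p. p \<in> nsets (insert t S) 2 \<Longrightarrow> \<chi> p = g ` p"
    using t(2) by (rule position_colouredE) (rule that, simp_all)
  obtain h where h: "strict_mono_on (insert u S) h" "h ` insert u S \<subseteq> {..<k}"
      "\<And>p. p \<in> nsets (insert u S) 2 \<Longrightarrow> \<chi> p = h ` p"
    using u(2) by (rule position_colouredE) (rule that, simp_all)
  have eq: "g x = h x" if x: "x \<in> S" for x
  proof -
    \<comment> \<open>Since \<open>k \<ge> 3\<close>, the set \<open>S\<close> has at least two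
      elements, so \<open>x\<close> lies in a pair inside \<open>S\<close>, whose colour both
      \<open>g\<close> and \<open>h\<close> must match.\<close>
    have "S \<noteq> {x}" using S by auto
    then obtain y where y: "y \<in> S" "y \<noteq> x" using x by blast
    have "{x, y} \<in> nsets (insert t S) 2" "{x, y} \<in> nsets (insert u S) 2"
      using x y by (auto simp: nsets_def)
    then have "g ` {x, y} = h ` {x, y}" using g(3) h(3) by metis
    moreover have "strict_mono_on S g" "strict_mono_on S h"
      using g(1) h(1) by (auto simp: strict_mono_on_def)
    ultimately show ?thesis
      using strict_mono_on_eq_if_pair_images_eq x y by metis
  qed
  \<comment> \<open>An injective map on \<open>k\<close> points fills all \<open>k\<close>
    positions, so the added vertex takes the one position missing from the image of
    \<open>S\<close>.\<close>
  have full: "f ` insert v S = {..<k}"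
    if "v \<notin> S" "strict_mono_on (insert v S) f" "f ` insert v S \<subseteq> {..<k}"
    for v and f :: "'a \<Rightarrow> nat"
  proof (rule card_subset_eq)
    have "card (f ` insert v S) = card (insert v S)"
      using that(2) by (intro card_image strict_mono_on_imp_inj_on)
    then show "card (f ` insert v S) = card {..<k}"
      using that(1) S by simp
  qed (use that in auto)
  have "g t \<notin> g ` S" "h u \<notin> h ` S"
    using strict_mono_on_imp_inj_on[OF g(1)] strict_mono_on_imp_inj_on[OF h(1)] t(1) u(1)
    by (auto simp: inj_on_def)
  moreover have "g ` S = h ` S" using eq by auto
  moreover have "insert (g t) (g ` S) = insert (h u) (h ` S)"
    using full[OF t(1) g(1,2)] full[OF u(1) h(1,2)] by simp
  ultimately have "g t = h u" by auto
  moreover have "\<chi> {t, s} = {g t, g s}" "\<chi> {u, s} = {h u, h s}"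
  proof -
    have "{t, s} \<in> nsets (insert t S) 2" "{u, s} \<in> nsets (insert u S) 2"
      using s t(1) u(1) by (auto simp: nsets_def card_2_iff)
    then show "\<chi> {t, s} = {g t, g s}" "\<chi> {u, s} = {h u, h s}"
      using g(3) h(3) by force+
  qed
  ultimately show ?thesis using eq[OF s] by simp
qed

text \<open>The red edges through \<open>S\<close> give any two vertices of \<open>T\<close> the
  same colour towards each vertex of \<open>S\<close>. The edge through \<open>T\<close> contains
  one such vertex \<open>s\<close>, and its position map would have to send two vertices of
  \<open>T\<close> to one position.\<close>

lemma half_graph_not_position_coloured:
  fixes B :: "'b hypergraph" and \<chi> :: "nat set \<Rightarrow> nat set"
  assumes B: "is_half_graph k B" and k: "k \<ge> 3"
    and R: "\<And>e. e \<in> R \<Longrightarrow> position_coloured k \<chi> e"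
  shows "\<not> contains_copy (V, R) B"
proof
  assume "contains_copy (V, R) B"
  then obtain \<phi> where \<phi>: "inj_on \<phi> (verts B)" "\<And>e. e \<in> edges B \<Longrightarrow> \<phi> ` e \<in> R"
    unfolding contains_copy_def by auto
  from B obtain S T f where ST: "finite S" "finite T" "S \<inter> T = {}" "card S = k - 1"
      "card T = k - 1" and f: "f \<in> nsets (S \<union> T) k" "T \<subseteq> f" and vB: "verts B = S \<union> T"
    and eB: "edges B = insert f {e \<in> nsets (S \<union> T) k. S \<subseteq> e}"
    unfolding is_half_graph_def by (elim exE conjE) (rule that)
  \<comment> \<open>\<open>f\<close> has \<open>k\<close> elements and contains the
    \<open>k - 1\<close> elements of \<open>T\<close>, so it adds exactly one vertex, necessarily
    from \<open>S\<close>.\<close>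
  have "card (f - T) = 1"
    using f ST k by (simp add: nsets_def card_Diff_subset)
  then obtain s where s: "f - T = {s}" by (auto simp: card_1_singleton_iff)
  then have f_eq: "f = insert s T" and sS: "s \<in> S" "s \<notin> T"
    using f by (auto simp: nsets_def)
  have "T \<noteq> {}" using ST(5) k by auto
  then obtain t where t: "t \<in> T" by blast
  have "T \<noteq> {t}" using ST(5) k by auto
  then obtain u where u: "u \<in> T" "u \<noteq> t" using t by blast
  have inj: "inj_on \<phi> (S \<union> T)" using \<phi>(1) vB by simp
  have red: "position_coloured k \<chi> (insert (\<phi> v) (\<phi> ` S))" if "v \<in> T" for v
  proof -
    have "v \<notin> S" using that ST by auto
    then have "insert v S \<in> edges B"
      using that ST k by (auto simp: eB nsets_def)
    from R[OF \<phi>(2)[OF this]] show ?thesis by simp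
  qed
  have notin: "\<phi> v \<notin> \<phi> ` S" if "v \<in> T" for v
    using that inj ST(3) by (auto simp: inj_on_def)
  have "card (\<phi> ` S) = k - 1"
    using inj ST(4) by (metis card_image inj_on_Un)
  then have "\<chi> {\<phi> t, \<phi> s} = \<chi> {\<phi> u, \<phi> s}"
    using t u sS ST(1) k red notin
    by (intro position_coloured_extensions_agree[where S = "\<phi> ` S"]) auto
  moreover obtain g where g: "strict_mono_on (\<phi> ` f) g" "\<And>p. p \<in> nsets (\<phi> ` f) 2 \<Longrightarrow> \<chi> p = g ` p"
    using R[OF \<phi>(2)[of f]] eB by (auto elim: position_colouredE)
  moreover have ne: "\<phi> t \<noteq> \<phi> s" "\<phi> u \<noteq> \<phi> s" "\<phi> t \<noteq> \<phi> u"
    using inj t u sS by (auto simp: inj_on_def)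
  moreover have "{\<phi> t, \<phi> s} \<in> nsets (\<phi> ` f) 2" "{\<phi> u, \<phi> s} \<in> nsets (\<phi> ` f) 2"
    using t u f_eq ne by (auto simp: nsets_def card_insert_if)
  ultimately have "{g (\<phi> t), g (\<phi> s)} = {g (\<phi> u), g (\<phi> s)}" by (metis image_empty image_insert)
  then have "g (\<phi> t) = g (\<phi> u)" by (auto simp: doubleton_eq_iff)
  moreover have "\<phi> t \<in> \<phi> ` f" "\<phi> u \<in> \<phi> ` f" using t u f_eq by auto
  ultimately show False
    using ne(3) inj_onD[OF strict_mono_on_imp_inj_on[OF g(1)]] by blast
qed

section \<open>Counting colourings with no red \<open>k\<close>-set inside a fixed
  \<open>n\<close>-set\<close>

text \<open>Independence in counting form: a map splits into its restrictions to the disjoint blocks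
  \<open>P l\<close> and to the rest, and each block excludes just one of its
  \<open>card C ^ b\<close> restrictions, that of \<open>\<tau>\<close>.\<close>

lemma card_PiE_disjoint_mismatch:
  assumes fin: "finite D" "finite C" "finite L" and C: "C \<noteq> {}"
    and P: "\<And>l. l \<in> L \<Longrightarrow> P l \<subseteq> D" "\<And>l. l \<in> L \<Longrightarrow> card (P l) = b"
    and disj: "disjoint_family_on P L"
    and \<tau>: "\<And>l p. l \<in> L \<Longrightarrow> p \<in> P l \<Longrightarrow> \<tau> p \<in> C"
  shows "real (card {\<chi> \<in> D \<rightarrow>\<^sub>E C. \<forall>l\<in>L. \<exists>p\<in>P l. \<chi> p \<noteq> \<tau> p})
    \<le> (1 - 1 / real (card C) ^ b) ^ card L * real (card C) ^ card D"
proof -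
  define U where "U = (\<Union>l\<in>L. P l)"
  define X where "X = {\<chi> \<in> D \<rightarrow>\<^sub>E C. \<forall>l\<in>L. \<exists>p\<in>P l. \<chi> p \<noteq> \<tau> p}"
  define Y where "Y = (\<lambda>l. (P l \<rightarrow>\<^sub>E C) - {restrict \<tau> (P l)})"
  \<comment> \<open>\<open>F\<close> records these restrictions; an upper bound on
    \<open>card X\<close> only asks for its injectivity.\<close>
  define F where "F = (\<lambda>\<chi> :: 'a \<Rightarrow> 'b. (\<lambda>l\<in>L. restrict \<chi> (P l), restrict \<chi> (D - U)))"
  have finP: "finite (P l)" if "l \<in> L" for l
    using P(1)[OF that] fin(1) finite_subset by blast
  have U: "U \<subseteq> D" "card U = b * card L"
    using P fin disj finP by (auto simp: U_def card_UN_disjoint disjoint_family_on_def)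
  have "inj_on F X"
  proof (rule inj_onI)
    fix \<chi> \<psi> assume X: "\<chi> \<in> X" "\<psi> \<in> X" and eq: "F \<chi> = F \<psi>"
    have "\<chi> p = \<psi> p" if "p \<in> D" for p
    proof (cases "p \<in> U")
      case True
      then obtain l where l: "l \<in> L" "p \<in> P l" by (auto simp: U_def)
      then have "restrict \<chi> (P l) = restrict \<psi> (P l)"
        using eq by (auto simp: F_def dest!: fun_cong[of _ _ l])
      then show ?thesis using l by (metis restrict_apply')
    next
      case False
      then show ?thesis using eq that unfolding F_def by (metis DiffI prod.inject restrict_apply')
    qed
    moreover have "\<chi> \<in> extensional D" "\<psi> \<in> extensional D" using X by (auto simp: X_def PiE_def)
    ultimately show "\<chi> = \<psi>" by (metis extensionalityI)
  qed
  moreover have "F ` X \<subseteq> (PiE L Y) \<times> ((D - U) \<rightarrow>\<^sub>E C)"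
  proof
    fix z assume "z \<in> F ` X"
    then obtain \<chi> where \<chi>: "\<chi> \<in> X" "z = F \<chi>" by blast
    have "restrict \<chi> (P l) \<in> Y l" if "l \<in> L" for l
    proof -
      have "\<exists>p\<in>P l. \<chi> p \<noteq> \<tau> p" using \<chi>(1) that by (simp add: X_def)
      then obtain p where "p \<in> P l" "\<chi> p \<noteq> \<tau> p" ..
      then have "restrict \<chi> (P l) \<noteq> restrict \<tau> (P l)" by (metis restrict_apply')
      then show ?thesis using \<chi>(1) P(1)[OF that] by (auto simp: Y_def X_def)
    qed
    then show "z \<in> (PiE L Y) \<times> ((D - U) \<rightarrow>\<^sub>E C)"
      using \<chi> by (auto simp: F_def X_def)
  qed
  moreover have finY: "finite (Y l)" if "l \<in> L" for l
    using finP[OF that] fin by (auto simp: Y_def intro!: finite_PiE)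
  ultimately have "card X \<le> card ((PiE L Y) \<times> ((D - U) \<rightarrow>\<^sub>E C))"
    using fin by (intro card_inj_on_le) (auto intro!: finite_PiE)
  also have "\<dots> = (\<Prod>l\<in>L. card (Y l)) * card C ^ card (D - U)"
    using fin by (simp add: card_cartesian_product card_PiE)
  also have "(\<Prod>l\<in>L. card (Y l)) = (card C ^ b - 1) ^ card L"
  proof -
    have "card (Y l) = card C ^ b - 1" if "l \<in> L" for l
      unfolding Y_def using that \<tau> finP[OF that] P(2)[OF that]
      by (subst card_Diff_singleton) (auto simp: card_PiE)
    then show ?thesis by simp
  qed
  also have "card (D - U) = card D - b * card L"
    using U fin finite_subset[OF U(1)] by (simp add: card_Diff_subset)
  finally have "real (card X) \<le> real ((card C ^ b - 1) ^ card L * card C ^ (card D - b * card L))"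
    by (simp only: of_nat_le_iff)
  also have "\<dots> = (1 - 1 / real (card C) ^ b) ^ card L * real (card C) ^ card D"
  proof -
    \<comment> \<open>This makes \<open>card C ^ b\<close> at least 1, so the subtraction of natural
      numbers is exact.\<close>
    have C0: "card C > 0" using C fin by (simp add: card_gt_0_iff)
    then have "real (card C ^ b - 1) = (1 - 1 / real (card C) ^ b) * real (card C) ^ b"
      by (simp add: of_nat_diff field_simps Suc_leI)
    moreover have "b * card L \<le> card D" using U fin card_mono by metis
    then have "real (card C) ^ card D =
        (real (card C) ^ b) ^ card L * real (card C) ^ (card D - b * card L)"
      by (simp flip: power_mult power_add)
    ultimately show ?thesis by (simp add: power_mult_distrib)
  qed
  finally show ?thesis by (simp add: X_def)
qed

text \<open>
  The progressions with start u and difference km + v, for u and v below m, have their i-th term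
  in the i-th interval of length km. Two of them with two common terms therefore agree.
\<close>

lemma edge_disjoint_transversals:
  fixes A :: "'a::wellorder set"
  assumes A: "finite A" "card A = n" and k: "k > 0"
  obtains E :: "nat \<times> nat \<Rightarrow> 'a set" and L :: "(nat \<times> nat) set" and g :: "'a \<Rightarrow> nat"
  where "finite L" "card L = (n div k\<^sup>2)\<^sup>2"
    "\<And>l. l \<in> L \<Longrightarrow> E l \<in> nsets A k" "\<And>l. l \<in> L \<Longrightarrow> g ` E l \<subseteq> {..<k}"
    "\<And>l. l \<in> L \<Longrightarrow> strict_mono_on (E l) g"
    "disjoint_family_on (\<lambda>l. nsets (E l) 2) L"
proof -
  \<comment> \<open>The choice lets \<open>k\<close> intervals of length \<open>k * m\<close> fit
    below \<open>n\<close>.\<close>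
  define m where "m = n div k\<^sup>2"
  define x where "x = (\<lambda>l i. i * (k * m) + (fst l + i * snd l))" for l :: "nat \<times> nat" and i :: nat
  define L where "L = {..<m} \<times> {..<m}"
  obtain a where a: "bij_betw a {..<n} A" "strict_mono_on {..<n} a"
    using ex_bij_betw_strict_mono_card[OF A(1)] A(2) by metis
  \<comment> \<open>One map serves all \<open>E l\<close>: it gives the index of the interval that
    contains the rank of the vertex in \<open>A\<close>, counted from 0.\<close>
  define g where "g = (\<lambda>y. the_inv_into {..<n} a y div (k * m))"
  define E where "E = (\<lambda>l. (\<lambda>i. a (x l i)) ` {..<k})"
  \<comment> \<open>From \<open>fst l < m\<close> and \<open>i * snd l \<le> i * m\<close> the sum
    stays below \<open>Suc i * m\<close>, so the \<open>i\<close>-th term does not leave its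
    interval.\<close>
  have offset: "fst l + i * snd l < k * m" if "l \<in> L" "i < k" for l i
  proof -
    have "fst l < m" "snd l < m" using that by (auto simp: L_def)
    moreover from this have "i * snd l \<le> i * m" by simp
    moreover have "Suc i * m \<le> k * m" using that by (intro mult_right_mono) auto
    ultimately show ?thesis unfolding mult_Suc by linarith
  qed
  have x_div: "x l i div (k * m) = i" if "l \<in> L" "i < k" for l i
    using offset[OF that] unfolding x_def by (subst div_mult_self3) (auto intro: Nat.gr0I)
  have x_lt: "x l i < n" if "l \<in> L" "i < k" for l i
  proof -
    have "x l i < Suc i * (k * m)"
      using offset[OF that] unfolding x_def mult_Suc by linarith
    also have "\<dots> \<le> k * (k * m)" using that by (intro mult_right_mono) auto
    also have "\<dots> = k\<^sup>2 * m" by (simp add: power2_eq_square)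
    also have "\<dots> \<le> n" by (simp add: m_def)
    finally show ?thesis .
  qed
  have inj: "inj_on a {..<n}" using a by (simp add: bij_betw_def)
  have g: "g (a (x l i)) = i" if "l \<in> L" "i < k" for l i
    using x_lt[OF that] x_div[OF that] inj by (simp add: g_def the_inv_into_f_f)
  have a_less: "i < j" if "a i < a j" "i < n" "j < n" for i j
    using that a(2) by (metis lessThan_iff linorder_cases order_less_asym zero_le strict_mono_onD)
  have disj: "l = l'" if l: "l \<in> L" "l' \<in> L" and p: "p \<in> nsets (E l) 2" "p \<in> nsets (E l') 2" for l l' p
  proof -
    \<comment> \<open>Since \<open>g\<close> does not depend on \<open>l\<close>, a common vertex
      has the same index in both progressions.\<close>
    have x_eq: "x l (g w) = x l' (g w) \<and> a (x l (g w)) = w \<and> g w < k" if "w \<in> p" for w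
    proof -
      have "w \<in> E l" "w \<in> E l'" using that p by (auto simp: nsets_def)
      obtain i where i: "w = a (x l i)" "i < k" using \<open>w \<in> E l\<close> by (auto simp: E_def)
      obtain j where j: "w = a (x l' j)" "j < k" using \<open>w \<in> E l'\<close> by (auto simp: E_def)
      have "x l i = x l' j"
        using inj_onD[OF inj, of "x l i" "x l' j"] x_lt l i j by simp
      moreover have "g w = i" "g w = j" using g[OF l(1) i(2)] g[OF l(2) j(2)] i(1) j(1) by simp_all
      ultimately show ?thesis using i by simp
    qed
    obtain y z where yz: "p = {y, z}" "y \<noteq> z" using p(1) by (auto simp: nsets_def card_2_iff)
    then have yz_in: "y \<in> p" "z \<in> p" by auto
    have ne: "g y \<noteq> g z" using x_eq yz_in yz(2) by metis
    have "fst l + g y * snd l = fst l' + g y * snd l'" "fst l + g z * snd l = fst l' + g z * snd l'"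
      using x_eq[OF yz_in(1), THEN conjunct1] x_eq[OF yz_in(2), THEN conjunct1]
      by (simp_all add: x_def)
    \<comment> \<open>Over the integers the two equations can be subtracted; distinct indices then
      force equal differences, hence equal starts.\<close>
    then have e: "int (fst l) + int (g y) * int (snd l) = int (fst l') + int (g y) * int (snd l')"
       "int (fst l) + int (g z) * int (snd l) = int (fst l') + int (g z) * int (snd l')"
      by (metis of_nat_add of_nat_mult)+
    then have "(int (g y) - int (g z)) * (int (snd l) - int (snd l')) = 0" by (simp add: algebra_simps)
    then have "snd l = snd l'" using ne by simp
    then show ?thesis using e by (simp add: prod_eq_iff)
  qed
  show thesis
  proof (rule that[of L E g])
    show "finite L" "card L = (n div k\<^sup>2)\<^sup>2"
      by (auto simp: L_def m_def power2_eq_square)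
    fix l assume l: "l \<in> L"
    have "inj_on (\<lambda>i. a (x l i)) {..<k}"
      using g[OF l] by (intro inj_on_inverseI[where g = g]) auto
    then have "card (E l) = k" by (simp add: E_def card_image)
    moreover have "E l \<subseteq> A" using a(1) x_lt[OF l] by (auto simp: E_def bij_betw_def)
    ultimately show "E l \<in> nsets A k" by (auto simp: nsets_def E_def)
    show "g ` E l \<subseteq> {..<k}" using g[OF l] by (auto simp: E_def)
    show "strict_mono_on (E l) g"
    proof (rule strict_mono_onI)
      fix y z assume "y \<in> E l" "z \<in> E l" "y < z"
      then obtain i j where ij: "y = a (x l i)" "z = a (x l j)" "i < k" "j < k"
        by (auto simp: E_def)
      have "x l i < x l j" using \<open>y < z\<close> ij x_lt[OF l] a_less by blast
      then have "i \<le> j" using x_div[OF l] ij by (metis div_le_mono less_imp_le)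
      moreover have "i \<noteq> j" using \<open>y < z\<close> ij by auto
      ultimately show "g y < g z" using g[OF l] ij by simp
    qed
  next
    show "disjoint_family_on (\<lambda>l. nsets (E l) 2) L"
      unfolding disjoint_family_on_def using disj by blast
  qed
qed

text \<open>Testing only the map \<open>g\<close> on each transversal \<open>E l\<close> gives
  disjoint blocks of pairs with one forbidden pattern each. The factor
  \<open>q ^ (N choose 2)\<close> counts all colourings, so the other factor bounds a
  probability.\<close>

lemma card_no_position_coloured_subset:
  fixes k n N :: nat and A :: "nat set"
  defines "q \<equiv> real (k choose 2)"
  assumes k: "k \<ge> 2" and A: "A \<in> nsets {..<N} n"
  shows "real (card {\<chi> \<in> nsets {..<N} 2 \<rightarrow>\<^sub>E nsets {..<k} 2. \<forall>e \<in> nsets A k. \<not> position_coloured k \<chi> e})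
    \<le> (1 - 1 / q ^ (k choose 2)) ^ (n div k\<^sup>2)\<^sup>2 * q ^ (N choose 2)"
proof -
  have A': "finite A" "card A = n" "A \<subseteq> {..<N}" using A by (auto simp: nsets_def)
  have k0: "k > 0" using k by simp
  obtain E :: "nat \<times> nat \<Rightarrow> nat set" and L g where
    L: "finite L" "card L = (n div k\<^sup>2)\<^sup>2"
    and E: "\<And>l. l \<in> L \<Longrightarrow> E l \<in> nsets A k" "\<And>l. l \<in> L \<Longrightarrow> g ` E l \<subseteq> {..<k}"
      "\<And>l. l \<in> L \<Longrightarrow> strict_mono_on (E l) g"
    and disj: "disjoint_family_on (\<lambda>l. nsets (E l) 2) L"
    by (rule edge_disjoint_transversals[OF A'(1,2) k0]) (rule that, simp_all)
  have "\<exists>p \<in> nsets (E l) 2. \<chi> p \<noteq> g ` p" if "l \<in> L" "\<not> position_coloured k \<chi> (E l)" for l \<chi>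
    using that(2) E(2,3)[OF that(1)] by (auto simp: position_coloured_def)
  then have sub: "{\<chi> \<in> nsets {..<N} 2 \<rightarrow>\<^sub>E nsets {..<k} 2. \<forall>e \<in> nsets A k. \<not> position_coloured k \<chi> e}
    \<subseteq> {\<chi> \<in> nsets {..<N} 2 \<rightarrow>\<^sub>E nsets {..<k} 2. \<forall>l\<in>L. \<exists>p\<in>nsets (E l) 2. \<chi> p \<noteq> g ` p}"
    using E(1) by (intro Collect_mono) blast
  have C: "nsets {..<k} 2 \<noteq> {}"
    using k by (auto simp: nsets_eq_empty_iff)
  have "g ` p \<in> nsets {..<k} 2" if "l \<in> L" "p \<in> nsets (E l) 2" for l p
  proof -
    have "inj_on g p"
      using that strict_mono_on_imp_inj_on[OF E(3)[OF that(1)]]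
      by (auto simp: nsets_def intro: inj_on_subset)
    then show ?thesis using that E(2)[OF that(1)] by (auto simp: nsets_def card_image)
  qed
  moreover have "nsets (E l) 2 \<subseteq> nsets {..<N} 2" "card (nsets (E l) 2) = k choose 2"
    if "l \<in> L" for l
  proof -
    have "E l \<subseteq> A" "card (E l) = k" using E(1)[OF that] by (auto simp: nsets_def)
    then show "nsets (E l) 2 \<subseteq> nsets {..<N} 2" "card (nsets (E l) 2) = k choose 2"
      using A'(3) by (auto intro!: nsets_mono)
  qed
  ultimately have "real (card {\<chi> \<in> nsets {..<N} 2 \<rightarrow>\<^sub>E nsets {..<k} 2.
        \<forall>l\<in>L. \<exists>p\<in>nsets (E l) 2. \<chi> p \<noteq> g ` p})
    \<le> (1 - 1 / real (card (nsets {..<k} 2)) ^ (k choose 2)) ^ card L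
        * real (card (nsets {..<k} 2)) ^ card (nsets {..<N} 2)"
    using L(1) C disj
    by (intro card_PiE_disjoint_mismatch) (simp_all add: finite_imp_finite_nsets)
  also have "\<dots> = (1 - 1 / q ^ (k choose 2)) ^ (n div k\<^sup>2)\<^sup>2 * q ^ (N choose 2)"
    by (simp add: L q_def)
  finally show ?thesis
    using card_mono[OF _ sub] by (force simp: finite_imp_finite_nsets finite_PiE)
qed

section \<open>Union bound over all \<open>n\<close>-sets\<close>

text \<open>\<open>1 / Q\<close> is the probability that a given \<open>k\<close>-set is red. The
  exponent allowed for \<open>N\<close> is chosen so that \<open>N ^ n\<close>, a bound for the
  number of \<open>n\<close>-sets, is outweighed by \<open>(1 - 1 / Q) ^ M\<close>.\<close>

lemma exists_position_colouring:
  fixes k n N :: nat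
  defines "Q \<equiv> real (k choose 2) ^ (k choose 2)"
  assumes k: "k \<ge> 2" and n: "n \<ge> k\<^sup>2" and N: "real N \<le> 2 powr (real n / (4 * real k ^ 4 * Q))"
  obtains \<chi> where "\<And>A. A \<in> nsets {..<N} n \<Longrightarrow> \<exists>e \<in> nsets A k. position_coloured k \<chi> e"
proof -
  define F where "F = nsets {..<N} 2 \<rightarrow>\<^sub>E nsets {..<k} 2"
  define bad where "bad = (\<lambda>A. {\<chi> \<in> F. \<forall>e \<in> nsets A k. \<not> position_coloured k \<chi> e})"
  define M where "M = (n div k\<^sup>2)\<^sup>2"
  define q where "q = real (k choose 2)"
  have finF: "finite F" by (simp add: F_def finite_imp_finite_nsets finite_PiE)
  have cardF: "real (card F) = q ^ (N choose 2)"
    by (simp add: F_def q_def card_PiE finite_imp_finite_nsets)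
  have q: "q \<ge> 1" using k by (simp add: q_def Suc_leI zero_less_binomial)
  have Q: "Q = q ^ (k choose 2)" "Q \<ge> 1" using q by (auto simp: Q_def q_def)
  have n0: "n > 0" using n k by (metis gr0I le_zero_eq power_eq_0_iff zero_neq_numeral)
  \<comment> \<open>As \<open>n \<ge> k\<^sup>2\<close>, rounding down in the division loses at most
    a factor 2; squaring yields the constant \<open>4 * real k ^ 4\<close>.\<close>
  have "real n \<le> 2 * real k ^ 2 * real (n div k\<^sup>2)"
  proof -
    have "n div k\<^sup>2 \<ge> 1" using n k by (simp add: Suc_leI div_greater_zero_iff)
    then have "k\<^sup>2 \<le> k\<^sup>2 * (n div k\<^sup>2)" by simp
    moreover have "n < k\<^sup>2 * (n div k\<^sup>2) + k\<^sup>2"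
      using k by (metis add_strict_left_mono mod_less_divisor mult_div_mod_eq not_numeral_le_zero zero_less_power neq0_conv)
    ultimately have "n \<le> 2 * k\<^sup>2 * (n div k\<^sup>2)" by linarith
    then have "real n \<le> real (2 * k\<^sup>2 * (n div k\<^sup>2))" by (rule of_nat_mono)
    then show ?thesis by simp
  qed
  then have "(real n)\<^sup>2 \<le> (2 * real k ^ 2 * real (n div k\<^sup>2))\<^sup>2" by (intro power_mono) auto
  also have "\<dots> = 4 * real k ^ 4 * real M"
    by (simp add: M_def power_mult_distrib flip: power_mult)
  finally have M: "(real n)\<^sup>2 / (4 * real k ^ 4 * Q) \<le> real M / Q"
    using k Q(2) by (simp add: field_simps)
  have bound: "real N ^ n * (1 - 1 / Q) ^ M < 1"
  proof -
    \<comment> \<open>\<open>z\<close> is \<open>n\<close> times the exponent in the bound on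
      \<open>N\<close>, and the fact \<open>M\<close> shows that it is at most
      \<open>real M / Q\<close>.\<close>
    define z where "z = (real n)\<^sup>2 / (4 * real k ^ 4 * Q)"
    have z: "z > 0" using n0 k Q(2) by (simp add: z_def)
    have "real N ^ n \<le> (2 powr (real n / (4 * real k ^ 4 * Q))) ^ n"
      using N by (intro power_mono) auto
    also have "\<dots> = exp (ln 2 * z)"
      by (simp add: powr_def z_def power2_eq_square mult_ac flip: exp_of_nat_mult)
    \<comment> \<open>The strict inequality of the whole estimate comes from \<open>ln 2 < 1\<close>
      together with \<open>z > 0\<close>.\<close>
    also have "\<dots> < exp z" using z ln_2_less_1 by simp
    also have "\<dots> \<le> exp (real M / Q)" using M by (simp add: z_def)
    finally have 1: "real N ^ n < exp (real M / Q)" .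
    have "(1 - 1 / Q) ^ M \<le> exp (- (1 / Q)) ^ M"
      using Q(2) exp_ge_add_one_self[of "- (1 / Q)"] by (intro power_mono) auto
    also have "\<dots> = exp (- (real M / Q))" by (simp flip: exp_of_nat_mult)
    finally have "real N ^ n * (1 - 1 / Q) ^ M \<le> real N ^ n * exp (- (real M / Q))"
      by (intro mult_left_mono) auto
    also have "\<dots> < exp (real M / Q) * exp (- (real M / Q))"
      using 1 by (intro mult_strict_right_mono) auto
    finally show ?thesis by (simp flip: exp_add)
  qed
  \<comment> \<open>Union bound in counting form: the colourings that are bad for some
    \<open>n\<close>-set do not exhaust \<open>F\<close>.\<close>
  have "real (card (\<Union>A \<in> nsets {..<N} n. bad A)) \<le> real (\<Sum>A \<in> nsets {..<N} n. card (bad A))"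
    by (intro of_nat_mono card_UN_le) (simp add: finite_imp_finite_nsets)
  also have "\<dots> \<le> (\<Sum>A \<in> nsets {..<N} n. (1 - 1 / Q) ^ M * real (card F))"
    unfolding of_nat_sum
    using card_no_position_coloured_subset[OF k]
    by (intro sum_mono) (simp add: bad_def F_def[symmetric] M_def Q(1) cardF, simp add: q_def F_def)
  also have "\<dots> = real (N choose n) * ((1 - 1 / Q) ^ M * real (card F))" by simp
  also have "\<dots> \<le> real N ^ n * ((1 - 1 / Q) ^ M * real (card F))"
  proof -
    have "N choose n \<le> N ^ n"
      by (cases "n \<le> N") (auto simp: binomial_le_pow binomial_eq_0)
    then have "real (N choose n) \<le> real N ^ n" by (metis of_nat_le_iff of_nat_power)
    then show ?thesis using Q(2) by (intro mult_right_mono) auto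
  qed
  also have "\<dots> < real (card F)"
  proof -
    have "real (card F) > 0" using cardF q by simp
    then show ?thesis
      using mult_strict_right_mono[OF bound, of "real (card F)"] by (simp only: mult.assoc mult_1)
  qed
  finally have "card (\<Union>A \<in> nsets {..<N} n. bad A) < card F" by simp
  then have "(\<Union>A \<in> nsets {..<N} n. bad A) \<noteq> F" by auto
  moreover have "(\<Union>A \<in> nsets {..<N} n. bad A) \<subseteq> F" by (auto simp: bad_def)
  ultimately obtain \<chi> where "\<chi> \<in> F" "\<And>A. A \<in> nsets {..<N} n \<Longrightarrow> \<chi> \<notin> bad A" by blast
  then show thesis by (intro that[of \<chi>]) (auto simp: bad_def)
qed

section \<open>Blue cliques and the final bound\<close>

text \<open>A copy has an \<open>n\<close>-set as its image, and every \<open>k\<close>-subset of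
  that image comes from a \<open>k\<close>-subset of \<open>{..<n}\<close>, so it would lie in
  \<open>E\<close>.\<close>

lemma not_contains_copy_complete_hypergraph:
  assumes E: "\<And>A. A \<in> nsets V n \<Longrightarrow> \<exists>e \<in> nsets A k. e \<notin> E"
  shows "\<not> contains_copy (V, E) (complete_hypergraph k n)"
proof
  assume "contains_copy (V, E) (complete_hypergraph k n)"
  then obtain \<phi> where \<phi>: "inj_on \<phi> {..<n}" "\<phi> ` {..<n} \<subseteq> V"
      "\<And>e. e \<in> nsets {..<n} k \<Longrightarrow> \<phi> ` e \<in> E"
    unfolding contains_copy_def complete_hypergraph_def by auto
  have "\<phi> ` {..<n} \<in> nsets V n" using \<phi> by (auto simp: nsets_def card_image)
  then obtain e where e: "e \<in> nsets (\<phi> ` {..<n}) k" "e \<notin> E" using E by blast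
  then have "e \<in> (`) \<phi> ` nsets {..<n} k"
    using nset_image_obtains[OF _ \<phi>(1)] by blast
  then show False using \<phi>(3) e(2) by blast
qed

theorem theorem6:
  fixes k :: nat
  assumes "k \<ge> 3"
  shows "\<exists>c::real. c > 0 \<and>
           (\<exists>n0::nat. \<forall>n\<ge>n0. \<forall>B :: nat hypergraph. is_half_graph k B \<longrightarrow>
              real (ramsey_number k B (complete_hypergraph k n)) > 2 powr (c * real n))"
proof -
  define Q where "Q = real (k choose 2) ^ (k choose 2)"
  \<comment> \<open>This is the rate in \<open>exists_position_colouring\<close>; it depends on
    \<open>k\<close> alone.\<close>
  define c where "c = 1 / (4 * real k ^ 4 * Q)"
  have "c > 0" using assms by (simp add: c_def Q_def zero_less_binomial)
  moreover have "real (ramsey_number k B (complete_hypergraph k n)) > 2 powr (c * real n)"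
    if n: "n \<ge> k\<^sup>2" and B: "is_half_graph k B" for n and B :: "nat hypergraph"
  proof (rule ccontr)
    \<comment> \<open>Colouring exactly as many points as the Ramsey number avoids any appeal to
      monotonicity of \<open>ramsey_arrow\<close> in \<open>N\<close>.\<close>
    define N where "N = ramsey_number k B (complete_hypergraph k n)"
    assume "\<not> ?thesis"
    then have "real N \<le> 2 powr (real n / (4 * real k ^ 4 * Q))" by (simp add: N_def c_def)
    moreover have "k \<ge> 2" using assms by simp
    ultimately obtain \<chi> where
      \<chi>: "\<And>A. A \<in> nsets {..<N} n \<Longrightarrow> \<exists>e \<in> nsets A k. position_coloured k \<chi> e"
      using exists_position_colouring n unfolding Q_def by metis
    define R where "R = {e \<in> nsets {..<N} k. position_coloured k \<chi> e}"
    \<comment> \<open>Existence of some suitable number makes \<open>LEAST\<close> a true minimum,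
      so the property holds at \<open>N\<close> itself.\<close>
    have "ramsey_arrow k N B (complete_hypergraph k n)"
      unfolding N_def ramsey_number_def
      using ramsey_arrow_half_graph_exists[OF B] by (rule LeastI_ex)
    moreover have "R \<subseteq> nsets {..<N} k" by (auto simp: R_def)
    ultimately have "contains_copy ({..<N}, R) B \<or>
        contains_copy ({..<N}, nsets {..<N} k - R) (complete_hypergraph k n)"
      unfolding ramsey_arrow_def by blast
    moreover have "\<not> contains_copy ({..<N}, R) B"
      by (rule half_graph_not_position_coloured[OF B assms, where \<chi> = \<chi>]) (simp add: R_def)
    moreover have "\<exists>e \<in> nsets A k. e \<notin> nsets {..<N} k - R" if "A \<in> nsets {..<N} n" for A
      using \<chi>[OF that] that by (auto simp: R_def nsets_def)
    then have "\<not> contains_copy ({..<N}, nsets {..<N} k - R) (complete_hypergraph k n)"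
      by (rule not_contains_copy_complete_hypergraph)
    ultimately show False by blast
  qed
  ultimately show ?thesis by blast
qed

end
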